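(* Let $\rho,\sigma\in\mathcal{D}(\mathcal{H})$ be quantum states. For $\gamma\in(0,1]$ define $$c_\gamma(\rho\|\sigma):=\frac1\gamma\log\big(2^{\gamma D_{1+\gamma}(\rho\|\sigma)}+2^{-\gamma D_{1-\gamma}(\rho\|\sigma)}+1\big).$$ Then for all $\gamma\in(0,1]$ and $\delta\in(0,\frac\gamma2]$: $$D_{1+\delta}(\rho\|\sigma)\le D(\rho\|\sigma)+\ln(2)\,\delta\,(c_\gamma(\rho\|\sigma))^2\le D(\rho\|\sigma)+\delta\,(c_\gamma(\rho\|\sigma))^2.$$ Furthermore, if $D(\rho\|\sigma)<\infty$, then for all $\gamma\in(0,1]$ and $\delta\in(0,\frac\gamma2]$: $$D_{1-\delta}(\rho\|\sigma)\ge D(\rho\|\sigma)-\ln(2)\,\delta\,(c_\gamma(\rho\|\sigma))^2\cosh\!\big(\ln(2)\,\delta\,c_\gamma(\rho\|\sigma)\big),$$ and for all $\gamma\in(0,1]$ and $\delta\in\big(0,\frac{\log 3}{2c_\gamma(\rho\|\sigma)}\big]$: $$D_{1-\delta}(\rho\|\sigma)\ge D(\rho\|\sigma)-\ln(2)\cosh\!\big(\tfrac{\log 3}{2}\big)\,\delta\,(c_\gamma(\rho\|\sigma))^2\ge D(\rho\|\sigma)-\delta\,(c_\gamma(\rho\|\sigma))^2.$$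
   Context: $\mathcal{H}$ is a finite-dimensional complex Hilbert space, $\mathcal{D}(\mathcal{H})$ its set of density matrices; $\log$ is base two, $\ln$ natural (so $\cosh(\frac{\log 3}{2})$ uses $\log_2 3$). Relative entropy: $D(\rho\|\sigma):=\operatorname{Tr}(\rho(\log\rho-\log\sigma))$ if $\operatorname{supp}\rho\subseteq\operatorname{supp}\sigma$, and $+\infty$ otherwise. Petz--Rényi divergence, for $\alpha\in[0,1)\cup(1,2]$ and $\operatorname{supp}\rho\subseteq\operatorname{supp}\sigma$: $D_\alpha(\rho\|\sigma):=\frac{1}{\alpha-1}\log\operatorname{Tr}(\rho^\alpha\sigma^{1-\alpha})$, with negative powers taken on the support and $\rho^0$ the projection onto the support of $\rho$. If $\operatorname{supp}\rho\not\subseteq\operatorname{supp}\sigma$, then $D_\alpha(\rho\|\sigma)=+\infty$ for $\alpha>1$ and $c_\gamma(\rho\|\sigma)=+\infty$ (in that case the first chain of inequalities is trivial, all its terms being $+\infty$). *)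

theory Defs
  imports
    "Jordan_Normal_Form.Spectral_Radius"
    "Jordan_Normal_Form.Matrix_Kernel"
    "HOL-Library.Extended_Real"
begin

text \<open>A Hilbert space of dimension \<open>n\<close> is identified with \<open>\<complex>\<^sup>n\<close>, i.e.\ \<open>carrier_vec n\<close>,
  and its operators with \<open>carrier_mat n n\<close>.\<close>

definition mat_trace :: "complex mat \<Rightarrow> complex" where
  "mat_trace A = (\<Sum>i<dim_row A. A $$ (i, i))"

definition hermitian :: "complex mat \<Rightarrow> bool" where
  "hermitian A \<longleftrightarrow> mat_adjoint A = A"

definition unitary :: "nat \<Rightarrow> complex mat \<Rightarrow> bool" where
  "unitary n U \<longleftrightarrow> U \<in> carrier_mat n n \<and> mat_adjoint U * U = 1\<^sub>m n"

definition density_matrices :: "nat \<Rightarrow> complex mat set" where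
  "density_matrices n = {\<rho> \<in> carrier_mat n n. hermitian \<rho> \<and>
     (\<forall>v\<in>carrier_vec n. 0 \<le> Re ((\<rho> *\<^sub>v v) \<bullet>c v)) \<and> mat_trace \<rho> = 1}"

text \<open>The support of a Hermitian matrix is the orthogonal complement of its kernel.\<close>

definition supp :: "complex mat \<Rightarrow> complex vec set" where
  "supp A = {v \<in> carrier_vec (dim_col A). \<forall>w\<in>mat_kernel A. v \<bullet>c w = 0}"

definition spectral_decomp :: "complex mat \<Rightarrow> complex mat \<Rightarrow> (nat \<Rightarrow> real) \<Rightarrow> bool" where
  "spectral_decomp A U d \<longleftrightarrow> unitary (dim_row A) U \<and>
     A = U * mat_diag (dim_row A) (\<lambda>i. complex_of_real (d i)) * mat_adjoint U"

text \<open>Functional calculus: if \<open>A = U diag(d) U\<^sup>*\<close> then \<open>f(A) = U diag(f \<circ> d) U\<^sup>*\<close>.  For Hermitian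
  \<open>A\<close> such a decomposition exists and the result does not depend on it; see
  \<open>spectral_decomp_exists\<close> and \<open>mat_fun_eq\<close> below.\<close>

definition mat_fun :: "(real \<Rightarrow> real) \<Rightarrow> complex mat \<Rightarrow> complex mat" where
  "mat_fun f A = (THE B. \<exists>U d. spectral_decomp A U d \<and>
     B = U * mat_diag (dim_row A) (\<lambda>i. complex_of_real (f (d i))) * mat_adjoint U)"

text \<open>Powers and logarithms are taken on the support.  Note \<open>0 powr a = 0\<close> for every real \<open>a\<close>,
  including \<open>a \<le> 0\<close>; in particular \<open>mat_powr A 0\<close> is the projection onto the support.\<close>

definition mat_powr :: "complex mat \<Rightarrow> real \<Rightarrow> complex mat" where
  "mat_powr A a = mat_fun (\<lambda>x. x powr a) A"

definition mat_log2 :: "complex mat \<Rightarrow> complex mat" where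
  "mat_log2 A = mat_fun (\<lambda>x. if x = 0 then 0 else log 2 x) A"

text \<open>The traces below are real for Hermitian arguments, so \<^const>\<open>Re\<close> only adjusts the type.\<close>

definition rel_entropy :: "complex mat \<Rightarrow> complex mat \<Rightarrow> ereal" where
  "rel_entropy \<rho> \<sigma> =
     (if supp \<rho> \<subseteq> supp \<sigma> then ereal (Re (mat_trace (\<rho> * (mat_log2 \<rho> - mat_log2 \<sigma>)))) else \<infinity>)"

definition petz_trace :: "real \<Rightarrow> complex mat \<Rightarrow> complex mat \<Rightarrow> real" where
  "petz_trace \<alpha> \<rho> \<sigma> = Re (mat_trace (mat_powr \<rho> \<alpha> * mat_powr \<sigma> (1 - \<alpha>)))"

text \<open>Meant for \<open>\<alpha> \<in> [0,1) \<union> (1,2]\<close>.  For \<open>\<alpha> < 1\<close> without inclusion of supports the usual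
  extension is used: the same formula, and \<open>\<infinity>\<close> if the trace vanishes.\<close>

definition petz_renyi :: "real \<Rightarrow> complex mat \<Rightarrow> complex mat \<Rightarrow> ereal" where
  "petz_renyi \<alpha> \<rho> \<sigma> =
     (if supp \<rho> \<subseteq> supp \<sigma> \<or> (\<alpha> < 1 \<and> petz_trace \<alpha> \<rho> \<sigma> \<noteq> 0)
      then ereal (1 / (\<alpha> - 1) * log 2 (petz_trace \<alpha> \<rho> \<sigma>)) else \<infinity>)"

text \<open>When the supports are included both divergences are finite, so \<^const>\<open>real_of_ereal\<close>
  discards nothing.\<close>

definition c_const :: "real \<Rightarrow> complex mat \<Rightarrow> complex mat \<Rightarrow> ereal" where
  "c_const \<gamma> \<rho> \<sigma> =
     (if supp \<rho> \<subseteq> supp \<sigma>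
      then ereal (1 / \<gamma> * log 2 (2 powr (\<gamma> * real_of_ereal (petz_renyi (1 + \<gamma>) \<rho> \<sigma>)) +
                                2 powr (- \<gamma> * real_of_ereal (petz_renyi (1 - \<gamma>) \<rho> \<sigma>)) + 1))
      else \<infinity>)"

lemma rel_entropy_finite_iff: "rel_entropy \<rho> \<sigma> < \<infinity> \<longleftrightarrow> supp \<rho> \<subseteq> supp \<sigma>"
  unfolding rel_entropy_def by (cases "supp \<rho> \<subseteq> supp \<sigma>") simp_all

lemma petz_renyi_finite: "supp \<rho> \<subseteq> supp \<sigma> \<Longrightarrow> \<bar>petz_renyi \<alpha> \<rho> \<sigma>\<bar> \<noteq> \<infinity>"
  by (simp add: petz_renyi_def)

lemma c_const_finite: "rel_entropy \<rho> \<sigma> < \<infinity> \<Longrightarrow> \<bar>c_const \<gamma> \<rho> \<sigma>\<bar> \<noteq> \<infinity>"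
  unfolding rel_entropy_finite_iff by (simp add: c_const_def)


subsection \<open>Well-definedness of the functional calculus\<close>

lemma mat_adjoint_carrier[simp]: "A \<in> carrier_mat n m \<Longrightarrow> mat_adjoint A \<in> carrier_mat m n"
  by (auto simp: mat_adjoint_def)

lemma mat_adjoint_dim[simp]: "dim_row (mat_adjoint A) = dim_col A" "dim_col (mat_adjoint A) = dim_row A"
  by (auto simp: mat_adjoint_def)

lemma mat_adjoint_index[simp]:
  "i < dim_col A \<Longrightarrow> j < dim_row A \<Longrightarrow> mat_adjoint A $$ (i, j) = cnj (A $$ (j, i))"
  by (simp add: mat_adjoint_def mat_of_rows_def)

lemma mat_adjoint_adjoint[simp]: "mat_adjoint (mat_adjoint A) = (A :: complex mat)"
  by (rule eq_matI) auto

lemma mat_adjoint_mult: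
  assumes "A \<in> carrier_mat n m" "B \<in> carrier_mat m k"
  shows "mat_adjoint (A * B) = mat_adjoint B * (mat_adjoint A :: complex mat)"
  using assms by (intro eq_matI) (auto simp: scalar_prod_def ac_simps)

lemma unitary_right_inv:
  assumes "unitary n U" shows "U * mat_adjoint U = 1\<^sub>m n"
  using assms mat_mult_left_right_inverse[of "mat_adjoint U" n U] by (auto simp: unitary_def)

lemma unitary_mult:
  assumes "unitary n U" "unitary n V" shows "unitary n (U * V)"
proof -
  have c: "U \<in> carrier_mat n n" "V \<in> carrier_mat n n" using assms by (auto simp: unitary_def)
  have "mat_adjoint (U * V) * (U * V) = mat_adjoint V * (mat_adjoint U * U) * V"
    using c by (simp add: mat_adjoint_mult[of _ n n] assoc_mult_mat[of _ n n _ n _ n] mult_carrier_mat[of _ n n _ n])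
  also have "\<dots> = 1\<^sub>m n" using assms c by (simp add: unitary_def)
  finally show ?thesis using c by (simp add: unitary_def)
qed

lemma mat_fun_unique:
  assumes 1: "spectral_decomp A U d" and 2: "spectral_decomp A V e"
  shows "U * mat_diag (dim_row A) (\<lambda>i. complex_of_real (f (d i))) * mat_adjoint U
       = V * mat_diag (dim_row A) (\<lambda>i. complex_of_real (f (e i))) * mat_adjoint V"
proof -
  define n where "n = dim_row A"
  define W where "W = mat_adjoint V * U"
  let ?D = "\<lambda>g. mat_diag n (\<lambda>i. complex_of_real (g i))"
  have U: "unitary n U" "A = U * ?D d * mat_adjoint U" using 1 by (auto simp: spectral_decomp_def n_def)
  have V: "unitary n V" "A = V * ?D e * mat_adjoint V" using 2 by (auto simp: spectral_decomp_def n_def)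
  have [simp]: "U \<in> carrier_mat n n" "V \<in> carrier_mat n n" "W \<in> carrier_mat n n"
    using U(1) V(1) by (auto simp: unitary_def W_def)
  have UU: "mat_adjoint U * U = 1\<^sub>m n" "U * mat_adjoint U = 1\<^sub>m n"
    and VV: "mat_adjoint V * V = 1\<^sub>m n" "V * mat_adjoint V = 1\<^sub>m n"
    using U(1) V(1) unitary_right_inv by (auto simp: unitary_def)
  note assoc = assoc_mult_mat[of _ n n _ n _ n] mult_carrier_mat[of _ n n _ n]
    right_mult_one_mat[of _ n n] left_mult_one_mat[of _ n n]
  have "W * ?D d = mat_adjoint V * (U * ?D d * mat_adjoint U) * U"
    using UU by (simp add: W_def assoc)
  also have "\<dots> = mat_adjoint V * (V * ?D e * mat_adjoint V) * U" using U(2) V(2) by simp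
  also have "\<dots> = (mat_adjoint V * V) * ?D e * W" by (simp add: W_def assoc)
  also have "\<dots> = ?D e * W" by (simp add: VV assoc)
  finally have comm: "W * ?D d = ?D e * W" .
  have "W $$ (i, j) * of_real (f (d j)) = of_real (f (e i)) * W $$ (i, j)" if "i < n" "j < n" for i j
  proof -
    have "W $$ (i, j) * of_real (d j) = of_real (e i) * W $$ (i, j)"
      using arg_cong[OF comm, of "\<lambda>M. M $$ (i, j)"] that
      by (simp add: mat_diag_mult_right[of _ n] mat_diag_mult_left[of _ _ n])
    then have "W $$ (i, j) = 0 \<or> d j = e i" by auto
    then show ?thesis by auto
  qed
  then have comm': "W * ?D (\<lambda>i. f (d i)) = ?D (\<lambda>i. f (e i)) * W"
    by (intro eq_matI) (auto simp: mat_diag_mult_right[of _ n] mat_diag_mult_left[of _ _ n])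
  have "V * (W * ?D (\<lambda>i. f (d i))) * mat_adjoint U = (V * mat_adjoint V) * U * ?D (\<lambda>i. f (d i)) * mat_adjoint U"
    by (simp add: W_def assoc)
  then have l: "V * (W * ?D (\<lambda>i. f (d i))) * mat_adjoint U = U * ?D (\<lambda>i. f (d i)) * mat_adjoint U"
    by (simp add: VV assoc)
  have "V * (?D (\<lambda>i. f (e i)) * W) * mat_adjoint U = V * ?D (\<lambda>i. f (e i)) * mat_adjoint V * (U * mat_adjoint U)"
    by (simp add: W_def assoc)
  then have r: "V * (?D (\<lambda>i. f (e i)) * W) * mat_adjoint U = V * ?D (\<lambda>i. f (e i)) * mat_adjoint V"
    by (simp add: UU assoc)
  show ?thesis using l r comm' by (simp add: n_def)
qed

lemma mat_fun_eq:
  assumes "spectral_decomp A U d"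
  shows "mat_fun f A = U * mat_diag (dim_row A) (\<lambda>i. complex_of_real (f (d i))) * mat_adjoint U"
  unfolding mat_fun_def using assms by (intro the_equality) (auto intro: mat_fun_unique)

lemma spectral_decomp_exists:
  assumes "A \<in> carrier_mat n n" "hermitian A"
  shows "\<exists>U d. spectral_decomp A U d"
  using assms
proof (induction n arbitrary: A)
  case 0
  then have "spectral_decomp A (1\<^sub>m 0) (\<lambda>_. 0)"
    by (auto simp: spectral_decomp_def unitary_def)
  then show ?case by blast
next
  case (Suc n A)
  let ?N = "Suc n"
  note A = \<open>A \<in> carrier_mat ?N ?N\<close>
  have hA: "mat_adjoint A = A" using Suc.prems(2) by (simp add: hermitian_def)
  obtain e v where ev: "eigenvector A v e"
    using spectrum_non_empty[OF A] by (auto simp: spectrum_def eigenvalue_def)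
  then have v: "v \<in> carrier_vec ?N" "v \<noteq> 0\<^sub>v ?N" "A *\<^sub>v v = e \<cdot>\<^sub>v v"
    using A by (auto simp: eigenvector_def)
  interpret cof_vec_space ?N "TYPE(complex)" .
  define b where "b = basis_completion v"
  define ws where "ws = gram_schmidt ?N b"
  note bc = basis_completion[OF v(1,2), folded b_def]
  obtain vs where bv: "b = v # vs" using bc by (cases b) auto
  note gs = gram_schmidt_result[OF bc(2) bc(4) bc(5) refl, folded ws_def]
  have ws: "set ws \<subseteq> carrier_vec ?N" "corthogonal ws" "length ws = ?N" 
    using gs bc(6) by auto
  have ws0: "ws ! 0 = v" using gram_schmidt_hd[OF v(1), of vs, folded bv] ws(3)
    by (metis ws_def hd_conv_nth list.size(3) nat.distinct(1))
  have wc[simp]: "ws ! i \<in> carrier_vec ?N" if "i < ?N" for i using ws that by auto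
  define nrm where "nrm i = sqrt (Re (ws ! i \<bullet>c ws ! i))" for i
  have ip: "ws ! i \<bullet>c ws ! j = (if i = j then of_real (nrm i ^ 2) else 0)" 
    and np: "nrm i > 0" if "i < ?N" "j < ?N" for i j
  proof -
    have ge: "0 \<le> ws ! i \<bullet>c ws ! i" by (rule conjugate_square_ge_0_vec)
    have ne: "ws ! i \<bullet>c ws ! i \<noteq> 0" using corthogonalD[OF ws(2), of i i] that ws(3) by auto
    have R: "Re (ws ! i \<bullet>c ws ! i) > 0" "Im (ws ! i \<bullet>c ws ! i) = 0"
      using ge ne by (auto simp: less_eq_complex_def complex_eq_iff)
    then show "nrm i > 0" by (simp add: nrm_def)
    show "ws ! i \<bullet>c ws ! j = (if i = j then of_real (nrm i ^ 2) else 0)"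
      using R corthogonalD[OF ws(2), of i j] that ws(3) by (auto simp: nrm_def complex_eq_iff)
  qed
  define W where "W = mat ?N ?N (\<lambda>(i, j). ws ! j $ i / of_real (nrm j))"
  have W[simp]: "W \<in> carrier_mat ?N ?N" by (simp add: W_def)
  have ip': "(\<Sum>k<?N. ws ! i $ k * cnj (ws ! j $ k)) = (if i = j then of_real (nrm i ^ 2) else 0)"
    if "i < ?N" "j < ?N" for i j
    using ip[OF that] carrier_vecD[OF wc[OF that(2)]] by (simp add: scalar_prod_def lessThan_atLeast0)
  have uW: "unitary ?N W"
    unfolding unitary_def
  proof (intro conjI W eq_matI)
    fix i j assume "i < dim_row (1\<^sub>m ?N :: complex mat)" "j < dim_col (1\<^sub>m ?N :: complex mat)"
    then have ij: "i < ?N" "j < ?N" by auto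
    have "(mat_adjoint W * W) $$ (i, j) = (\<Sum>k<?N. cnj (W $$ (k, i)) * W $$ (k, j))"
      using ij W by (auto simp: scalar_prod_def lessThan_atLeast0 simp del: W)
    also have "\<dots> = (\<Sum>k<?N. ws ! j $ k * cnj (ws ! i $ k)) / of_real (nrm i * nrm j)"
      unfolding sum_divide_distrib using ij by (intro sum.cong) (auto simp: W_def)
    also have "\<dots> = 1\<^sub>m ?N $$ (i, j)"
      using ij np[OF ij] by (subst ip') (auto simp: power2_eq_square)
    finally show "(mat_adjoint W * W) $$ (i, j) = 1\<^sub>m ?N $$ (i, j)" .
  qed (auto simp: W_def)
  have WW: "mat_adjoint W * W = 1\<^sub>m ?N" "W * mat_adjoint W = 1\<^sub>m ?N"
    using uW unitary_right_inv by (auto simp: unitary_def)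
  define B where "B = mat_adjoint W * A * W"
  have B[simp]: "B \<in> carrier_mat ?N ?N" using A by (simp add: B_def mult_carrier_mat[of _ ?N ?N _ ?N])
  note assoc = assoc_mult_mat[of _ ?N ?N _ ?N _ ?N] mult_carrier_mat[of _ ?N ?N _ ?N]
    right_mult_one_mat[of _ ?N ?N] left_mult_one_mat[of _ ?N ?N]
  have hB: "mat_adjoint B = B"
    using A by (simp add: B_def mat_adjoint_mult[of _ ?N ?N _ ?N] hA assoc)
  have AB: "A = W * B * mat_adjoint W"
  proof -
    have "W * B * mat_adjoint W = (W * mat_adjoint W) * A * (W * mat_adjoint W)"
      using A by (simp add: B_def assoc)
    then show ?thesis using A by (simp add: WW)
  qed
  have "A *\<^sub>v col W 0 = e \<cdot>\<^sub>v col W 0"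
  proof -
    have "col W 0 = (1 / of_real (nrm 0)) \<cdot>\<^sub>v v"
      using v(1) by (intro eq_vecI) (auto simp: W_def ws0)
    then show ?thesis using A v by (simp add: mult_mat_vec smult_smult_assoc mult.commute)
  qed
  then have AW0: "col (A * W) 0 = e \<cdot>\<^sub>v col W 0" using A W by (subst col_mult2[of _ ?N ?N _ ?N]) auto
  have B0: "B $$ (i, 0) = (if i = 0 then e else 0)" if i: "i < ?N" for i
  proof -
    have "B $$ (i, 0) = row (mat_adjoint W) i \<bullet> col (A * W) 0"
      using A W i by (simp add: B_def assoc del: W) 
    also have "\<dots> = e * (row (mat_adjoint W) i \<bullet> col W 0)"
      unfolding AW0 using W i by (simp del: W)
    also have "row (mat_adjoint W) i \<bullet> col W 0 = (mat_adjoint W * W) $$ (i, 0)"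
      using W i by (simp del: W)
    finally show ?thesis using i by (simp add: WW)
  qed
  have Bh: "B $$ (i, j) = cnj (B $$ (j, i))" if "i < ?N" "j < ?N" for i j
    using mat_adjoint_index[of i B j] that hB B by (auto simp del: B)
  have e: "e = of_real (Re e)" using Bh[of 0 0] B0[of 0] by (simp add: complex_eq_iff)
  define C where "C = mat n n (\<lambda>(i, j). B $$ (Suc i, Suc j))"
  have C[simp]: "C \<in> carrier_mat n n" by (simp add: C_def)
  have "hermitian C" unfolding hermitian_def
    by (rule eq_matI) (auto simp: C_def Bh[symmetric])
  from Suc.IH[OF C this] obtain V d where "spectral_decomp C V d" by blast
  then have V: "unitary n V" "C = V * mat_diag n (\<lambda>i. of_real (d i)) * mat_adjoint V"
    using C by (auto simp: spectral_decomp_def simp del: C)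
  have Vc[simp]: "V \<in> carrier_mat n n" using V(1) by (simp add: unitary_def)
  define X where "X = mat ?N ?N (\<lambda>(i, j). if i = 0 \<or> j = 0 then (if i = j then 1 else 0)
                                     else V $$ (i - 1, j - 1))"
  define d' where "d' = case_nat (Re e) d"
  have X[simp]: "X \<in> carrier_mat ?N ?N" by (simp add: X_def)
  have sumS: "(\<Sum>k = 0..<?N. g k) = g 0 + (\<Sum>k = 0..<n. g (Suc k))" for g :: "nat \<Rightarrow> complex"
    by (rule sum.atLeast0_lessThan_Suc_shift[unfolded o_def])
  have VVi: "(\<Sum>k=0..<n. cnj (V $$ (k, i)) * V $$ (k, j)) = (if i = j then 1 else 0)"
    if "i < n" "j < n" for i j
  proof -
    have "(mat_adjoint V * V) $$ (i, j) = (\<Sum>k=0..<n. cnj (V $$ (k, i)) * V $$ (k, j))"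
      using that Vc by (auto simp: scalar_prod_def simp del: Vc)
    then show ?thesis using V(1) that by (simp add: unitary_def)
  qed
  have Ci: "B $$ (Suc i, Suc j) = (\<Sum>k=0..<n. V $$ (i, k) * of_real (d k) * cnj (V $$ (j, k)))"
    if "i < n" "j < n" for i j
  proof -
    have "B $$ (Suc i, Suc j) = C $$ (i, j)" using that by (simp add: C_def)
    also have "\<dots> = (\<Sum>k=0..<n. V $$ (i, k) * of_real (d k) * cnj (V $$ (j, k)))"
      using that Vc by (subst V(2)) (auto simp: mat_diag_mult_right[OF Vc] scalar_prod_def simp del: Vc)
    finally show ?thesis .
  qed
  have uX: "unitary ?N X"
    unfolding unitary_def
  proof (intro conjI X eq_matI)
    fix i j assume "i < dim_row (1\<^sub>m ?N :: complex mat)" "j < dim_col (1\<^sub>m ?N :: complex mat)"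
    then have ij: "i < ?N" "j < ?N" by auto
    have "(mat_adjoint X * X) $$ (i, j) = (\<Sum>k=0..<?N. cnj (X $$ (k, i)) * X $$ (k, j))"
      using ij X by (auto simp: scalar_prod_def simp del: X)
    also have "\<dots> = 1\<^sub>m ?N $$ (i, j)"
      unfolding sumS using ij VVi by (cases i; cases j) (auto simp: X_def)
    finally show "(mat_adjoint X * X) $$ (i, j) = 1\<^sub>m ?N $$ (i, j)" .
  qed (auto simp: X_def)
  have BX: "B = X * mat_diag ?N (\<lambda>i. of_real (d' i)) * mat_adjoint X" (is "_ = ?R")
  proof (rule eq_matI)
    fix i j assume "i < dim_row ?R" "j < dim_col ?R"
    then have ij: "i < ?N" "j < ?N" by (auto simp: X_def)
    have "?R $$ (i, j) = (\<Sum>k=0..<?N. X $$ (i, k) * of_real (d' k) * cnj (X $$ (j, k)))"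
      using ij X by (auto simp: mat_diag_mult_right[OF X] scalar_prod_def simp del: X)
    also have "\<dots> = B $$ (i, j)"
    proof (cases i)
      case 0
      have "B $$ (0, j) = (if j = 0 then e else 0)" using Bh[of 0 j] B0[of j] ij e
        by (auto simp: complex_eq_iff)
      then show ?thesis unfolding sumS using 0 ij e by (cases j) (auto simp: X_def d'_def)
    next
      case (Suc i')
      then show ?thesis unfolding sumS using ij B0[of i] Ci by (cases j) (auto simp: X_def d'_def)
    qed
    finally show "B $$ (i, j) = ?R $$ (i, j)" by simp
  qed (use B X in \<open>auto simp del: B X\<close>)
  have "A = (W * X) * mat_diag ?N (\<lambda>i. of_real (d' i)) * mat_adjoint (W * X)"
    unfolding AB BX by (simp add: mat_adjoint_mult[of _ ?N ?N _ ?N] assoc)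
  then have "spectral_decomp A (W * X) d'"
    using A unitary_mult[OF uW uX] by (auto simp: spectral_decomp_def)
  then show ?case by blast
qed

end

theory Submission
  imports Defs "HOL-Analysis.Harmonic_Numbers"
begin

text \<open>Diagonalise \<open>\<rho> = \<Sum>\<^sub>i p\<^sub>i |u\<^sub>i\<rangle>\<langle>u\<^sub>i|\<close> and \<open>\<sigma> = \<Sum>\<^sub>j q\<^sub>j |v\<^sub>j\<rangle>\<langle>v\<^sub>j|\<close>.  Under the
  Nussbaum--Szkola distribution \<open>P(i,j) = p\<^sub>i |\<langle>u\<^sub>i|v\<^sub>j\<rangle>|\<^sup>2\<close> the variable \<open>X = ln p\<^sub>i - ln q\<^sub>j\<close>
  has mean \<open>ln 2 D(\<rho>\<parallel>\<sigma>)\<close>, and its moment generating function at \<open>t\<close> is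
  \<open>Tr (\<rho>\<^bsup>1+t\<^esup> \<sigma>\<^bsup>-t\<^esup>)\<close>, so that the claim is one about scalar random variables.  With
  \<open>w = ln 2 \<delta> c\<^sub>\<gamma>\<close>, Jensen's inequality gives \<open>E (2 cosh (\<delta> X)) \<le> 2 cosh w\<close>, and
  \<open>e\<^sup>x \<le> x + 2 cosh x - 1\<close> turns this into \<open>E e\<^bsup>\<plusminus>\<delta>X\<^esup> \<le> \<plusminus>\<delta> E X + 2 cosh w - 1\<close>.
  The lower bounds follow from \<open>ln x \<le> x - 1\<close> and \<open>2 cosh w - 2 \<le> w\<^sup>2 cosh w\<close>.  The upper bound
  without the factor \<open>cosh\<close> uses \<open>2 cosh w - 1 \<le> exp (w\<^sup>2)\<close> and \<open>E X \<ge> 0\<close>, the latter because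
  both states have trace one.\<close>

section \<open>Scalar inequalities for \<open>cosh\<close>, powers and logarithms\<close>

lemma sinh_le_mult_cosh:
  fixes x :: real
  assumes "0 \<le> x"
  shows "sinh x \<le> x * cosh x"
proof -
  have "0 * cosh 0 - sinh (0::real) \<le> x * cosh x - sinh x"
  proof (rule DERIV_nonneg_imp_nondecreasing[OF assms, of "\<lambda>x. x * cosh x - sinh x"])
    fix y :: real assume "0 \<le> y"
    have "((\<lambda>x. x * cosh x - sinh x) has_real_derivative y * sinh y) (at y)"
      by (auto intro!: derivative_eq_intros)
    then show "\<exists>d. ((\<lambda>x. x * cosh x - sinh x) has_real_derivative d) (at y) \<and> 0 \<le> d"
      using \<open>0 \<le> y\<close> by (intro exI[of _ "y * sinh y"]) simp
  qed
  then show ?thesis by simp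
qed

text \<open>The quotient of the two sides has a derivative with the sign of
  \<open>sinh y - y * cosh y\<close>, so it decreases on the nonnegative half-line; evenness covers
  negative \<open>x\<close>.\<close>

lemma cosh_le_exp_half_square:
  fixes x :: real
  shows "cosh x \<le> exp (x\<^sup>2 / 2)"
proof -
  let ?f = "\<lambda>x. cosh x * exp (- (x\<^sup>2 / 2)) :: real"
  have "?f \<bar>x\<bar> \<le> ?f 0"
  proof (rule DERIV_nonpos_imp_nonincreasing[OF abs_ge_zero])
    fix y :: real assume "0 \<le> y"
    have "(?f has_real_derivative (sinh y - y * cosh y) * exp (- (y\<^sup>2 / 2))) (at y)"
      by (auto intro!: derivative_eq_intros simp: algebra_simps)
    then show "\<exists>d. (?f has_real_derivative d) (at y) \<and> d \<le> 0"
      using sinh_le_mult_cosh[OF \<open>0 \<le> y\<close>]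
      by (intro exI conjI) (auto simp: mult_le_0_iff)
  qed
  then show ?thesis by (simp add: exp_minus field_simps)
qed

text \<open>With \<open>y = exp (x\<^sup>2 / 2)\<close> the previous bound reduces this to
  \<open>2 * y - 1 \<le> y\<^sup>2\<close>, that is, to
  \<open>(y - 1)\<^sup>2 \<ge> 0\<close>.\<close>

lemma two_cosh_minus_one_le_exp_square:
  fixes x :: real
  shows "2 * cosh x - 1 \<le> exp (x\<^sup>2)"
proof -
  let ?y = "exp (x\<^sup>2 / 2)"
  have "2 * cosh x - 1 \<le> 2 * ?y - 1" using cosh_le_exp_half_square[of x] by simp
  also have "\<dots> \<le> ?y\<^sup>2" using zero_le_power2[of "?y - 1"] by (simp add: power2_diff)
  also have "\<dots> = exp (x\<^sup>2)" by (simp flip: exp_double)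
  finally show ?thesis .
qed

text \<open>Halving the argument turns the left side into \<open>4 * (sinh y)\<^sup>2\<close>. Then
  \<open>sinh y \<le> y * cosh y\<close>, and \<open>(cosh y)\<^sup>2 \<le> 2 * (cosh y)\<^sup>2 - 1
  = cosh (2 * y)\<close>.\<close>

lemma two_cosh_minus_two_le:
  fixes x :: real
  shows "2 * cosh x - 2 \<le> x\<^sup>2 * cosh x"
proof -
  define y where "y = \<bar>x\<bar> / 2"
  have y: "0 \<le> y" "cosh x = cosh (2 * y)" "x\<^sup>2 = 4 * y\<^sup>2"
    by (auto simp: y_def power2_eq_square)
  have c: "cosh (2 * y) = 2 * (sinh y)\<^sup>2 + 1" "cosh (2 * y) = 2 * (cosh y)\<^sup>2 - 1"
    using cosh_square_eq[of y] by (simp_all add: cosh_double)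
  have "2 * cosh x - 2 = 4 * (sinh y)\<^sup>2" using c(1) y by simp
  also have "\<dots> \<le> 4 * (y * cosh y)\<^sup>2"
    using y(1) sinh_le_mult_cosh[OF y(1)] by (intro mult_left_mono power_mono) auto
  also have "\<dots> = x\<^sup>2 * (cosh y)\<^sup>2" by (simp add: y power_mult_distrib)
  also have "\<dots> \<le> x\<^sup>2 * cosh x"
    unfolding y(2) c(2) using cosh_real_ge_1[of y] one_le_power[of "cosh y" 2]
    by (intro mult_left_mono) auto
  finally show ?thesis .
qed

text \<open>The upper bound is 243 = 3 ^ 5 \<le> 2 ^ 8 = 256; it supplies the exponent 4 / 5 of the
  next estimate.\<close>

lemma log2_3_bounds: "1 \<le> log 2 (3::real)" "log 2 (3::real) \<le> 8 / 5"
proof -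
  show "1 \<le> log 2 (3::real)" by (simp add: le_log_iff)
  have "5 * log 2 (3::real) = log 2 (3 ^ 5)" by (subst log_nat_power) auto
  also have "\<dots> \<le> log 2 (2 ^ 8)" by (subst log_le_cancel_iff) auto
  finally show "log 2 (3::real) \<le> 8 / 5" by (subst (asm) log_nat_power) auto
qed

text \<open>This absorbs the constant in the last inequality of the theorem. Rational bounds
  suffice: e < 2.72 gives \<open>exp (4 / 5) \<le> 9 / 4\<close>, and with
  \<open>ln 2 \<le> 25 / 36\<close> the product is at most 2425 / 2592.\<close>

lemma ln2_cosh_log2_3_le_1: "ln 2 * cosh (log 2 3 / 2) \<le> (1::real)"
proof -
  have "exp (4 / 5 :: real) ^ 5 = exp 1 ^ 4" by (simp flip: exp_of_nat_mult)
  also have "\<dots> \<le> (272 / 100) ^ 4" using e_less_272 by (intro power_mono) auto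
  also have "\<dots> \<le> (9 / 4 :: real) ^ 5" by (simp add: power_divide)
  finally have e: "exp (4 / 5 :: real) \<le> 9 / 4" by (rule power_le_imp_le_base[of _ 4, simplified]) auto
  let ?y = "exp (4 / 5 :: real)"
  have "cosh (log 2 3 / 2) \<le> cosh (4 / 5 :: real)"
    using log2_3_bounds by (subst cosh_real_nonneg_le_iff) auto
  also have "\<dots> = (?y + 1 / ?y) / 2" by (simp add: cosh_def exp_minus field_simps)
  also have "\<dots> \<le> (9 / 4 + 4 / 9) / 2"
  proof -
    \<comment> \<open>Since 4 / 9 is the reciprocal of 9 / 4, expanding and dividing by
      \<open>?y\<close> gives \<open>?y + 1 / ?y \<le> 9 / 4 + 4 / 9\<close>.\<close>
    have "0 \<le> (9 / 4 - ?y) * (?y - 4 / 9)"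
      using e one_le_exp_iff[of "4 / 5 :: real"] by (intro mult_nonneg_nonneg) linarith+
    then show ?thesis by (simp add: field_simps)
  qed
  finally have "ln 2 * cosh (log 2 3 / 2) \<le> 25 / 36 * ((9 / 4 + 4 / 9) / 2 :: real)"
    using ln2_le_25_over_36 by (intro mult_mono) auto
  also have "\<dots> \<le> 1" by simp
  finally show ?thesis .
qed

text \<open>The function \<open>ln ((1 + s) / (1 - s))\<close> is convex, vanishes at 0 and equals
  \<open>ln 3\<close> at 1 / 2, so it lies below the chord \<open>2 * s * ln 3\<close>.\<close>

lemma one_plus_over_one_minus_le_powr:
  fixes s :: real
  assumes "0 \<le> s" "s \<le> 1 / 2"
  shows "1 + s \<le> (1 - s) * 3 powr (2 * s)"
proof -
  let ?f = "\<lambda>s. ln (1 + s) - ln (1 - s) :: real"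
  have "convex_on {0..1/2} ?f"
  proof (rule f''_ge0_imp_convex[where f' = "\<lambda>s. 1 / (1 + s) + 1 / (1 - s)"
        and f'' = "\<lambda>s. 1 / (1 - s)\<^sup>2 - 1 / (1 + s)\<^sup>2"])
    fix x :: real assume x: "x \<in> {0..1/2}"
    show "(?f has_real_derivative 1 / (1 + x) + 1 / (1 - x)) (at x)"
      using x by (auto intro!: derivative_eq_intros)
    show "((\<lambda>s. 1 / (1 + s) + 1 / (1 - s)) has_real_derivative 1 / (1 - x)\<^sup>2 - 1 / (1 + x)\<^sup>2) (at x)"
      using x by (auto intro!: derivative_eq_intros simp: power2_eq_square)
    show "0 \<le> 1 / (1 - x)\<^sup>2 - 1 / (1 + x)\<^sup>2"
      using x by (auto intro!: divide_left_mono power_mono)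
  qed auto
  from convex_onD[OF this, of "2 * s" 0 "1 / 2"] assms
  have "?f s \<le> 2 * s * ?f (1 / 2)" by simp
  also have "?f (1 / 2) = ln (3::real)" using ln_div[of "3 / 2" "1 / 2 :: real"] by simp
  finally have "ln (1 + s) \<le> ln ((1 - s) * 3 powr (2 * s))"
    using assms by (simp add: ln_mult ln_powr)
  then show ?thesis using assms by simp
qed

text \<open>The second derivative is nonpositive once
  \<open>1 + s \<le> (1 - s) * t powr (2 * s)\<close>, which the previous lemma gives at
  \<open>t = 3\<close> and monotonicity beyond. For \<open>s = 1 / 2\<close> the threshold 3 is
  exact.\<close>

lemma concave_on_powr_add_powr_minus:
  fixes s :: real
  assumes "0 \<le> s" "s \<le> 1 / 2"
  shows "concave_on {3..} (\<lambda>t. t powr s + t powr (- s))"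
proof (rule f''_le0_imp_concave[where f' = "\<lambda>t. s * t powr (s - 1) - s * t powr (- s - 1)"
      and f'' = "\<lambda>t. s * ((s - 1) * t powr (s - 2)) + s * ((s + 1) * t powr (- s - 2))"])
  fix t :: real assume t: "t \<in> {3..}"
  show "((\<lambda>t. t powr s + t powr (- s)) has_real_derivative
      s * t powr (s - 1) - s * t powr (- s - 1)) (at t)"
    using t by (auto intro!: derivative_eq_intros simp: algebra_simps)
  show "((\<lambda>t. s * t powr (s - 1) - s * t powr (- s - 1)) has_real_derivative
      s * ((s - 1) * t powr (s - 2)) + s * ((s + 1) * t powr (- s - 2))) (at t)"
    using t by (auto intro!: derivative_eq_intros simp: algebra_simps)
  have "1 + s \<le> (1 - s) * 3 powr (2 * s)" by (rule one_plus_over_one_minus_le_powr[OF assms])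
  also have "\<dots> \<le> (1 - s) * t powr (2 * s)"
    using t assms by (intro mult_left_mono powr_mono2) auto
  finally have "(1 + s) * t powr (- s - 2) \<le> (1 - s) * t powr (2 * s) * t powr (- s - 2)"
    by (rule mult_right_mono) auto
  also have "\<dots> = (1 - s) * t powr (s - 2)"
    using t by (simp add: mult.assoc flip: powr_add)
  finally have "s * ((s - 1) * t powr (s - 2) + (s + 1) * t powr (- s - 2)) \<le> 0"
    using assms by (intro mult_nonneg_nonpos) (auto simp: algebra_simps)
  then show "s * ((s - 1) * t powr (s - 2)) + s * ((s + 1) * t powr (- s - 2)) \<le> 0"
    by (simp add: distrib_left)
qed auto

lemma two_cosh_eq: "2 * cosh x = exp x + exp (- x :: real)"
  by (simp add: cosh_def)

lemma powr_add_powr_minus_eq_cosh: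
  fixes s t :: real
  assumes "0 < t"
  shows "t powr s + t powr (- s) = 2 * cosh (s * ln t)"
  using assms by (simp add: powr_def cosh_def)

lemma cosh_mult_mono:
  fixes s :: real
  assumes "\<bar>x\<bar> \<le> y"
  shows "cosh (s * x) \<le> cosh (s * y)"
proof -
  have "cosh \<bar>s * x\<bar> \<le> cosh \<bar>s * y\<bar>"
    using assms by (subst cosh_real_nonneg_le_iff) (auto simp: abs_mult intro!: mult_left_mono)
  then show ?thesis by simp
qed

section \<open>Moment generating functions of finite distributions\<close>

locale finite_distribution =
  fixes S :: "'a set" and w X :: "'a \<Rightarrow> real"
  assumes finite_S: "finite S"
    and w_nonneg: "\<And>i. i \<in> S \<Longrightarrow> 0 \<le> w i"
    and sum_w: "sum w S = 1"
begin

definition mgf :: "real \<Rightarrow> real" where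
  "mgf t = (\<Sum>i\<in>S. w i * exp (t * X i))"

definition mean :: real where
  "mean = (\<Sum>i\<in>S. w i * X i)"

text \<open>The counterpart of \<open>c_const\<close> in natural units: it will equal
  \<open>ln 2\<close> times that constant.\<close>

definition cumulant_const :: "real \<Rightarrow> real" where
  "cumulant_const \<gamma> = ln (mgf \<gamma> + mgf (- \<gamma>) + 1) / \<gamma>"

lemma mgf_pos: "0 < mgf t"
proof -
  obtain i where "i \<in> S" "0 < w i"
    using sum_w w_nonneg by (metis less_eq_real_def sum.neutral zero_neq_one)
  then show ?thesis
    unfolding mgf_def using finite_S w_nonneg by (intro sum_pos2[of _ i]) auto
qed

lemma sum_mono_w: "(\<And>i. i \<in> S \<Longrightarrow> f i \<le> g i) \<Longrightarrow> (\<Sum>i\<in>S. w i * f i) \<le> (\<Sum>i\<in>S. w i * g i)"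
  using w_nonneg by (intro sum_mono mult_left_mono) auto

lemma mgf_ge: "1 + t * mean \<le> mgf t"
proof -
  have "1 + t * mean = (\<Sum>i\<in>S. w i * (1 + t * X i))"
    by (simp add: mean_def distrib_left sum.distrib sum_w sum_distrib_left mult_ac)
  also have "\<dots> \<le> mgf t" unfolding mgf_def by (intro sum_mono_w) (rule exp_ge_add_one_self)
  finally show ?thesis .
qed

text \<open>This is the nonnegativity of relative entropy, obtained from
  \<open>1 - mean \<le> mgf (- 1)\<close>.\<close>

lemma mean_nonneg: "mgf (- 1) \<le> 1 \<Longrightarrow> 0 \<le> mean"
  using mgf_ge[of "- 1"] by simp

lemma mgf_sym_sum: "mgf t + mgf (- t) + 1 = (\<Sum>i\<in>S. w i * (2 * cosh (t * X i) + 1))"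
  by (simp add: mgf_def cosh_def distrib_left sum.distrib sum_w)

lemma mgf_sym_ge_3: "3 \<le> mgf t + mgf (- t) + 1"
proof -
  have "3 = (\<Sum>i\<in>S. w i * 3)" by (simp flip: sum_distrib_right add: sum_w)
  also have "\<dots> \<le> mgf t + mgf (- t) + 1"
    unfolding mgf_sym_sum by (intro sum_mono_w) (simp add: cosh_real_ge_1)
  finally show ?thesis .
qed

text \<open>Serves to convert an upper bound on \<delta> in terms of the constant into \<delta>
  \<le> \<gamma> / 2.\<close>

lemma cumulant_const_ge:
  assumes "0 < \<gamma>"
  shows "ln 3 / \<gamma> \<le> cumulant_const \<gamma>"
  unfolding cumulant_const_def using assms mgf_sym_ge_3[of \<gamma>] by (intro divide_right_mono) auto

text \<open>For \<open>s \<le> 1 / 2\<close> the map \<open>t \<mapsto> 2 cosh (s ln t)\<close> is concave only on \<open>t \<ge> 3\<close>.  Replacing the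
  argument \<open>e\<^sup>Y\<close>, where \<open>Y = \<gamma> X\<close>, by \<open>e\<^sup>Y + e\<^sup>-\<^sup>Y + 1 \<ge> 3\<close> increases the value and makes Jensen's
  inequality applicable.\<close>

lemma sum_cosh_le:
  assumes "0 < \<delta>" "\<delta> \<le> \<gamma> / 2"
  shows "(\<Sum>i\<in>S. w i * cosh (\<delta> * X i)) \<le> cosh (\<delta> * cumulant_const \<gamma>)"
proof -
  \<comment> \<open>Chosen so that \<open>\<delta> * X i = s * (\<gamma> * X i)\<close>; the
    hypothesis \<delta> \<le> \<gamma> / 2 becomes \<open>s \<le> 1 / 2\<close>, the range in which
    concavity is known.\<close>
  define s where "s = \<delta> / \<gamma>"
  have g: "0 < \<gamma>" using assms by simp
  then have s: "0 \<le> s" "s \<le> 1 / 2" and sg: "s * \<gamma> = \<delta>" using assms by (auto simp: s_def field_simps)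
  define T where "T i = 2 * cosh (\<gamma> * X i) + 1" for i
  have T3: "3 \<le> T i" for i using cosh_real_ge_1[of "\<gamma> * X i"] by (simp add: T_def)
  have "\<bar>\<gamma> * X i\<bar> \<le> ln (T i)" for i
  proof -
    have "exp \<bar>\<gamma> * X i\<bar> \<le> T i" 
      unfolding T_def two_cosh_eq by (cases "0 \<le> \<gamma> * X i") (simp_all add: add_increasing add_increasing2)
    then show ?thesis using T3[of i] by (simp add: ln_ge_iff)
  qed
  from cosh_mult_mono[OF this, of s] have "cosh (\<delta> * X i) \<le> cosh (s * ln (T i))" for i
    by (simp add: sg mult.assoc[symmetric])
  then have "2 * (\<Sum>i\<in>S. w i * cosh (\<delta> * X i)) \<le> 2 * (\<Sum>i\<in>S. w i * cosh (s * ln (T i)))"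
    by (intro mult_left_mono sum_mono_w) auto
  also have "\<dots> = (\<Sum>i\<in>S. w i * (T i powr s + T i powr (- s)))"
  proof -
    have "T i powr s + T i powr (- s) = 2 * cosh (s * ln (T i))" for i
      using T3[of i] by (intro powr_add_powr_minus_eq_cosh) simp
    then show ?thesis by (simp add: sum_distrib_left mult_ac)
  qed
  also have "\<dots> \<le> (\<Sum>i\<in>S. w i *\<^sub>R T i) powr s + (\<Sum>i\<in>S. w i *\<^sub>R T i) powr (- s)"
    using finite_S sum_w w_nonneg T3
    by (intro concave_on_sum[OF _ _ concave_on_powr_add_powr_minus[OF s]]) auto
  also have "(\<Sum>i\<in>S. w i *\<^sub>R T i) = mgf \<gamma> + mgf (- \<gamma>) + 1"
    by (simp add: mgf_sym_sum T_def)
  also have "(mgf \<gamma> + mgf (- \<gamma>) + 1) powr s + (mgf \<gamma> + mgf (- \<gamma>) + 1) powr (- s)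
      = 2 * cosh (\<delta> * cumulant_const \<gamma>)"
    using mgf_sym_ge_3[of \<gamma>] by (subst powr_add_powr_minus_eq_cosh) (auto simp: cumulant_const_def s_def)
  finally show ?thesis by simp
qed

text \<open>Both signs of \<open>t\<close> are treated at once, since only the linear term sees the
  sign.\<close>

lemma mgf_le:
  assumes "0 < \<delta>" "\<delta> \<le> \<gamma> / 2" "\<bar>t\<bar> = \<delta>"
  shows "mgf t \<le> 1 + t * mean + (2 * cosh (\<delta> * cumulant_const \<gamma>) - 2)"
proof -
  have "t = \<delta> \<or> t = - \<delta>" using assms(3) by linarith
  then have cosh_t: "cosh (t * X i) = cosh (\<delta> * X i)" for i by auto
  have "mgf t \<le> (\<Sum>i\<in>S. w i * (t * X i + 2 * cosh (t * X i) - 1))"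
    unfolding mgf_def
  proof (rule sum_mono_w)
    fix i
    \<comment> \<open>After writing \<open>2 * cosh x\<close> as \<open>exp x + exp (- x)\<close>
      this is just \<open>1 - x \<le> exp (- x)\<close>.\<close>
    show "exp (t * X i) \<le> t * X i + 2 * cosh (t * X i) - 1"
      using exp_ge_add_one_self[of "- (t * X i)"] two_cosh_eq[of "t * X i"] by linarith
  qed
  also have "\<dots> = t * mean + 2 * (\<Sum>i\<in>S. w i * cosh (\<delta> * X i)) - 1"
    unfolding cosh_t by (simp add: mean_def algebra_simps sum.distrib sum_subtractf sum_w sum_distrib_left)
  finally show ?thesis using sum_cosh_le[OF assms(1,2)] by simp
qed

lemma ln_mgf_minus_le:
  assumes "0 < \<delta>" "\<delta> \<le> \<gamma> / 2"
  shows "ln (mgf (- \<delta>)) \<le> - \<delta> * mean + (\<delta> * cumulant_const \<gamma>)\<^sup>2 * cosh (\<delta> * cumulant_const \<gamma>)"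
  using ln_le_minus_one[OF mgf_pos, of "- \<delta>"] mgf_le[OF assms, of "- \<delta>"] assms(1)
    two_cosh_minus_two_le[of "\<delta> * cumulant_const \<gamma>"] by simp

lemma ln_mgf_le:
  assumes "0 < \<delta>" "\<delta> \<le> \<gamma> / 2" "0 \<le> mean"
  shows "ln (mgf \<delta>) \<le> \<delta> * mean + (\<delta> * cumulant_const \<gamma>)\<^sup>2"
proof -
  let ?e = "exp ((\<delta> * cumulant_const \<gamma>)\<^sup>2)"
  have "mgf \<delta> \<le> \<delta> * mean + ?e"
    using mgf_le[OF assms(1,2), of \<delta>] assms(1)
      two_cosh_minus_one_le_exp_square[of "\<delta> * cumulant_const \<gamma>"] by simp
  \<comment> \<open>Here \<open>0 \<le> mean\<close> enters: multiplying
    \<open>\<delta> * mean\<close> by \<open>?e \<ge> 1\<close> does not decrease it.\<close>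
  also have "\<dots> \<le> (1 + \<delta> * mean) * ?e"
    using assms mult_left_mono[of 1 ?e "\<delta> * mean"] by (simp add: distrib_right)
  also have "\<dots> \<le> exp (\<delta> * mean) * ?e"
    by (intro mult_right_mono exp_ge_add_one_self) auto
  finally show ?thesis using mgf_pos[of \<delta>] by (metis exp_add exp_gt_zero ln_exp ln_le_cancel_iff)
qed

end

section \<open>Traces of products of functions of two Hermitian matrices\<close>

lemma mat_trace_mult:
  assumes "A \<in> carrier_mat n n" "B \<in> carrier_mat n n"
  shows "mat_trace (A * B) = (\<Sum>k<n. \<Sum>l<n. A $$ (k, l) * B $$ (l, k))"
  using assms by (auto simp: mat_trace_def scalar_prod_def lessThan_atLeast0)

text \<open>For fixed eigenvector indices \<open>i\<close> and \<open>j\<close>, the sums over the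
  matrix indices \<open>k\<close> and \<open>l\<close> factor into an entry of
  \<open>mat_adjoint U * V\<close> and its conjugate.\<close>

lemma mat_trace_conj_diag_mult:
  fixes a b :: "nat \<Rightarrow> complex"
  assumes U: "U \<in> carrier_mat n n" and V: "V \<in> carrier_mat n n"
  shows "mat_trace (U * mat_diag n a * mat_adjoint U * (V * mat_diag n b * mat_adjoint V)) =
    (\<Sum>i<n. \<Sum>j<n. a i * b j * of_real ((cmod ((mat_adjoint U * V) $$ (i, j)))\<^sup>2))"
proof -
  let ?A = "U * mat_diag n a * mat_adjoint U" and ?B = "V * mat_diag n b * mat_adjoint V"
  have A: "?A \<in> carrier_mat n n" and B: "?B \<in> carrier_mat n n" using U V by auto
  have Ai: "?A $$ (k, l) = (\<Sum>i<n. U $$ (k, i) * a i * cnj (U $$ (l, i)))" if "k < n" "l < n" for k l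
    using that U by (auto simp: mat_diag_mult_right[OF U] scalar_prod_def lessThan_atLeast0)
  have Bi: "?B $$ (k, l) = (\<Sum>i<n. V $$ (k, i) * b i * cnj (V $$ (l, i)))" if "k < n" "l < n" for k l
    using that V by (auto simp: mat_diag_mult_right[OF V] scalar_prod_def lessThan_atLeast0)
  have Wi: "(mat_adjoint U * V) $$ (i, j) = (\<Sum>k<n. cnj (U $$ (k, i)) * V $$ (k, j))"
    if "i < n" "j < n" for i j
    using that U V by (auto simp: scalar_prod_def lessThan_atLeast0)
  have "mat_trace (?A * ?B) = (\<Sum>k<n. \<Sum>l<n. ?A $$ (k, l) * ?B $$ (l, k))"
    using A B by (rule mat_trace_mult)
  also have "\<dots> = (\<Sum>k<n. \<Sum>l<n. \<Sum>i<n. \<Sum>j<n. a i * b j *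
      (U $$ (k, i) * cnj (V $$ (k, j)) * (cnj (U $$ (l, i)) * V $$ (l, j))))"
    by (intro sum.cong refl) (simp add: Ai Bi sum_product mult_ac)
  also have "\<dots> = (\<Sum>i<n. \<Sum>j<n. \<Sum>k<n. \<Sum>l<n. a i * b j *
      (U $$ (k, i) * cnj (V $$ (k, j)) * (cnj (U $$ (l, i)) * V $$ (l, j))))"
    \<comment> \<open>Four adjacent swaps take the summation order k, l, i, j to i, j, k, l.\<close>
    apply (subst (2) sum.swap)
    apply (subst (1) sum.swap)
    apply (subst (3) sum.swap)
    apply (subst (2) sum.swap)
    apply (rule refl)
    done
  also have "\<dots> = (\<Sum>i<n. \<Sum>j<n. a i * b j * of_real ((cmod ((mat_adjoint U * V) $$ (i, j)))\<^sup>2))"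
  proof (intro sum.cong refl)
    fix i j assume "i \<in> {..<n}" "j \<in> {..<n}"
    then have W: "complex_of_real ((cmod ((mat_adjoint U * V) $$ (i, j)))\<^sup>2) =
        (\<Sum>k<n. U $$ (k, i) * cnj (V $$ (k, j))) * (\<Sum>l<n. cnj (U $$ (l, i)) * V $$ (l, j))"
      by (simp add: complex_norm_square Wi mult.commute del: of_real_power)
    show "(\<Sum>k<n. \<Sum>l<n. a i * b j * (U $$ (k, i) * cnj (V $$ (k, j)) * (cnj (U $$ (l, i)) * V $$ (l, j))))
        = a i * b j * of_real ((cmod ((mat_adjoint U * V) $$ (i, j)))\<^sup>2)"
      unfolding W sum_product by (simp only: sum_distrib_left)
  qed
  finally show ?thesis .
qed

lemma mat_fun_mult:
  assumes "A \<in> carrier_mat n n" "hermitian A"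
  shows "A * mat_fun f A = mat_fun (\<lambda>x. x * f x) A"
proof -
  obtain U d where sd: "spectral_decomp A U d" using spectral_decomp_exists[OF assms] by blast
  then have U: "U \<in> carrier_mat n n" "mat_adjoint U * U = 1\<^sub>m n"
    and A: "A = U * mat_diag n (\<lambda>i. of_real (d i)) * mat_adjoint U"
    using assms by (auto simp: spectral_decomp_def unitary_def)
  note assoc = assoc_mult_mat[of _ n n _ n _ n] mult_carrier_mat[of _ n n _ n]
    left_mult_one_mat[of _ n n]
  let ?D = "\<lambda>d. mat_diag n (\<lambda>i. complex_of_real (d i))"
  have "A * mat_fun f A = U * ?D d * (mat_adjoint U * U) * ?D (\<lambda>i. f (d i)) * mat_adjoint U"
    using assms(1) U(1) by (subst A, subst mat_fun_eq[OF sd]) (simp add: assoc)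
  also have "\<dots> = U * (?D d * ?D (\<lambda>i. f (d i))) * mat_adjoint U"
    unfolding U(2) using U(1) by (simp add: assoc del: mat_diag_diag)
  finally show ?thesis using assms(1) mat_fun_eq[OF sd, of "\<lambda>x. x * f x"] by simp
qed

text \<open>Lets the trace of a function of one matrix be read as a trace over two. The value 1 is
  also taken on the kernel, unlike in \<open>mat_powr A 0\<close>.\<close>

lemma mat_fun_const_one:
  assumes "A \<in> carrier_mat n n" "hermitian A"
  shows "mat_fun (\<lambda>_. 1) A = 1\<^sub>m n"
proof -
  obtain U d where sd: "spectral_decomp A U d" using spectral_decomp_exists[OF assms] by blast
  then have "unitary n U" using assms by (simp add: spectral_decomp_def)
  then show ?thesis
    using assms(1) unitary_right_inv[of n U]
    by (simp add: mat_fun_eq[OF sd] unitary_def right_mult_one_mat[of U n n])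
qed

lemma mat_fun_ident:
  assumes "A \<in> carrier_mat n n" "hermitian A"
  shows "mat_fun (\<lambda>x. x) A = A"
proof -
  obtain U d where sd: "spectral_decomp A U d" using spectral_decomp_exists[OF assms] by blast
  then show ?thesis unfolding mat_fun_eq[OF sd] by (simp add: spectral_decomp_def)
qed

lemma mat_fun_carrier:
  assumes "A \<in> carrier_mat n n" "hermitian A"
  shows "mat_fun f A \<in> carrier_mat n n"
proof -
  obtain U d where sd: "spectral_decomp A U d" using spectral_decomp_exists[OF assms] by blast
  then have "U \<in> carrier_mat n n" using assms by (simp add: spectral_decomp_def unitary_def)
  then show ?thesis using assms(1) by (simp add: mat_fun_eq[OF sd] mult_carrier_mat[of _ n n _ n])
qed

lemma mat_trace_minus:
  assumes "A \<in> carrier_mat n n" "B \<in> carrier_mat n n"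
  shows "mat_trace (A - B) = mat_trace A - mat_trace B"
  using assms by (auto simp: mat_trace_def sum_subtractf)

text \<open>Squared moduli of the inner products of two eigenbases, indexed by pairs because pairs
  form the sample space below.\<close>

definition overlap :: "complex mat \<Rightarrow> complex mat \<Rightarrow> nat \<times> nat \<Rightarrow> real" where
  "overlap U V = (\<lambda>(i, j). (cmod ((mat_adjoint U * V) $$ (i, j)))\<^sup>2)"

lemma overlap_nonneg: "0 \<le> overlap U V x"
  by (simp add: overlap_def split: prod.split)

text \<open>Normalisation, moment generating function and mean all arise from this formula by
  choosing \<open>f\<close> and \<open>g\<close>.\<close>

lemma mat_trace_mat_fun_mult:
  assumes "spectral_decomp A U d" "spectral_decomp B V e"
    and "A \<in> carrier_mat n n" "B \<in> carrier_mat n n"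
  shows "Re (mat_trace (mat_fun f A * mat_fun g B)) =
    (\<Sum>(i, j)\<in>{..<n} \<times> {..<n}. f (d i) * g (e j) * overlap U V (i, j))"
proof -
  have U: "U \<in> carrier_mat n n" "V \<in> carrier_mat n n"
    using assms by (auto simp: spectral_decomp_def unitary_def)
  have [simp]: "dim_row A = n" "dim_row B = n" using assms by auto
  have "mat_trace (mat_fun f A * mat_fun g B) =
      of_real (\<Sum>i<n. \<Sum>j<n. f (d i) * g (e j) * overlap U V (i, j))"
    unfolding mat_fun_eq[OF assms(1)] mat_fun_eq[OF assms(2)]
    by (simp add: mat_trace_conj_diag_mult[OF U] overlap_def)
  then show ?thesis by (simp add: sum.cartesian_product)
qed

section \<open>Eigenvectors, kernels and supports\<close>

lemma cscalar_prod_col_col: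
  fixes U V :: "complex mat"
  assumes "U \<in> carrier_mat n m" "V \<in> carrier_mat n k" "i < m" "j < k"
  shows "(mat_adjoint U * V) $$ (i, j) = col V j \<bullet>c col U i"
  using assms by (auto simp: scalar_prod_def mult.commute)

lemma spectral_decomp_mult_col:
  assumes "spectral_decomp A U d" "A \<in> carrier_mat n n" "i < n"
  shows "A *\<^sub>v col U i = of_real (d i) \<cdot>\<^sub>v col U i"
proof -
  have U: "U \<in> carrier_mat n n" "mat_adjoint U * U = 1\<^sub>m n"
    and A: "A = U * mat_diag n (\<lambda>i. of_real (d i)) * mat_adjoint U"
    using assms by (auto simp: spectral_decomp_def unitary_def)
  have "A * U = U * mat_diag n (\<lambda>i. of_real (d i)) * (mat_adjoint U * U)"
    using U(1) by (subst A) (simp add: assoc_mult_mat[of _ n n _ n _ n] mult_carrier_mat[of _ n n _ n])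
  then have AU: "A * U = U * mat_diag n (\<lambda>i. of_real (d i))"
    using U by (simp add: right_mult_one_mat[of _ n n] mult_carrier_mat[of _ n n _ n])
  have "A *\<^sub>v col U i = col (A * U) i" using assms U by (intro col_mult2[symmetric]) auto
  also have "\<dots> = of_real (d i) \<cdot>\<^sub>v col U i"
    unfolding AU using U(1) assms(3) by (auto simp: mat_diag_mult_right[OF U(1)])
  finally show ?thesis .
qed

text \<open>Applying \<open>mat_adjoint U\<close> to \<open>A *\<^sub>v w = 0\<^sub>v n\<close>
  leaves \<open>d i\<close> times the conjugate inner product. Hence eigenvectors with nonzero
  eigenvalue lie in the support.\<close>

lemma spectral_decomp_kernel_orthogonal:
  assumes "spectral_decomp A U d" "A \<in> carrier_mat n n" "i < n" "d i \<noteq> 0" "w \<in> mat_kernel A"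
  shows "col U i \<bullet>c w = 0"
proof -
  have U: "U \<in> carrier_mat n n" "mat_adjoint U * U = 1\<^sub>m n"
    and A: "A = U * mat_diag n (\<lambda>i. of_real (d i)) * mat_adjoint U"
    using assms by (auto simp: spectral_decomp_def unitary_def)
  have w: "w \<in> carrier_vec n" "A *\<^sub>v w = 0\<^sub>v n" using assms by (auto simp: mat_kernel_def)
  have "mat_adjoint U * A = (mat_adjoint U * U) * mat_diag n (\<lambda>i. of_real (d i)) * mat_adjoint U"
    using U(1) by (subst A) (simp add: assoc_mult_mat[of _ n n _ n _ n] mult_carrier_mat[of _ n n _ n])
  then have UA: "mat_adjoint U * A = mat_diag n (\<lambda>i. of_real (d i)) * mat_adjoint U"
    using U by (simp add: left_mult_one_mat[of _ n n])
  have "0\<^sub>v n = mat_adjoint U *\<^sub>v (A *\<^sub>v w)" using w U(1) by (intro eq_vecI) auto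
  also have "\<dots> = (mat_diag n (\<lambda>i. of_real (d i)) * mat_adjoint U) *\<^sub>v w"
    using assoc_mult_mat_vec[OF mat_adjoint_carrier[OF U(1)] assms(2) w(1)] by (simp add: UA)
  finally have "0 = vec_index ((mat_diag n (\<lambda>i. of_real (d i)) * mat_adjoint U) *\<^sub>v w) i"
    using assms(3) by (metis index_zero_vec(1))
  also have "\<dots> = of_real (d i) * cnj (col U i \<bullet>c w)"
    using U(1) w assms(3) mat_adjoint_carrier[OF U(1)]
    by (simp add: mat_diag_mult_left[of _ n n] scalar_prod_def sum_distrib_left mult_ac)
  finally show ?thesis using assms(4) by simp
qed

lemma spectral_decomp_eigenvalue_nonneg:
  assumes "spectral_decomp A U d" "A \<in> density_matrices n" "i < n"
  shows "0 \<le> d i"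
proof -
  have A: "A \<in> carrier_mat n n" using assms by (simp add: density_matrices_def)
  have U: "U \<in> carrier_mat n n" "mat_adjoint U * U = 1\<^sub>m n"
    using assms A by (auto simp: spectral_decomp_def unitary_def)
  have c: "col U i \<in> carrier_vec n" using U by auto
  have "0 \<le> Re ((A *\<^sub>v col U i) \<bullet>c col U i)"
    using assms(2) c by (simp add: density_matrices_def)
  also have "(A *\<^sub>v col U i) \<bullet>c col U i = of_real (d i) * (mat_adjoint U * U) $$ (i, i)"
    using c U(1) assms(3) cscalar_prod_col_col[OF U(1) U(1) assms(3) assms(3)]
    by (simp add: spectral_decomp_mult_col[OF assms(1) A assms(3)])
  finally show ?thesis using U assms(3) by simp
qed

text \<open>The first eigenvector lies in \<open>supp A\<close>, hence in \<open>supp B\<close>; the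
  second lies in the kernel of \<open>B\<close>.\<close>

lemma overlap_eq_0:
  assumes "spectral_decomp A U d" "spectral_decomp B V e"
    and "A \<in> carrier_mat n n" "B \<in> carrier_mat n n" "supp A \<subseteq> supp B"
    and "i < n" "j < n" "d i \<noteq> 0" "e j = 0"
  shows "overlap U V (i, j) = 0"
proof -
  have U: "U \<in> carrier_mat n n" "V \<in> carrier_mat n n"
    using assms by (auto simp: spectral_decomp_def unitary_def)
  have "col U i \<in> supp A"
    using spectral_decomp_kernel_orthogonal[OF assms(1,3,6,8)] assms(3,6) U
    by (auto simp: supp_def)
  moreover have "col V j \<in> mat_kernel B"
    using spectral_decomp_mult_col[OF assms(2,4,7)] assms(4,7,9) U
    by (auto simp: mat_kernel_def)
  ultimately have "col U i \<bullet>c col V j = 0" using assms(5) by (auto simp: supp_def)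
  then have "(mat_adjoint V * U) $$ (j, i) = 0" using cscalar_prod_col_col[OF U(2,1)] assms by simp
  moreover have "(mat_adjoint U * V) $$ (i, j) = cnj ((mat_adjoint V * U) $$ (j, i))"
    using U assms(6,7) by (auto simp: scalar_prod_def mult.commute)
  ultimately show ?thesis by (simp add: overlap_def)
qed

section \<open>The Nussbaum-Szkola distribution\<close>

lemma density_spectral_decomp:
  assumes "A \<in> density_matrices n"
  obtains U d where "spectral_decomp A U d" "\<And>i. i < n \<Longrightarrow> 0 \<le> d i"
  using assms spectral_decomp_exists[of A n] spectral_decomp_eigenvalue_nonneg[of A _ _ n]
  by (auto simp: density_matrices_def)

text \<open>Everything the theorem needs to know about the two states, in scalar form.\<close>

lemma nussbaum_szkola:
  assumes "\<rho> \<in> density_matrices n" "\<sigma> \<in> density_matrices n" "supp \<rho> \<subseteq> supp \<sigma>"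
  obtains S :: "(nat \<times> nat) set" and P X where
    "finite_distribution S P"
    "finite_distribution.mgf S P X (- 1) \<le> 1"
    "\<forall>t. petz_trace (1 + t) \<rho> \<sigma> = finite_distribution.mgf S P X t"
    "rel_entropy \<rho> \<sigma> = ereal (finite_distribution.mean S P X / ln 2)"
proof -
  obtain U p where U: "spectral_decomp \<rho> U p" and p: "\<And>i. i < n \<Longrightarrow> 0 \<le> p i"
    using density_spectral_decomp[OF assms(1)] by blast
  obtain V q where V: "spectral_decomp \<sigma> V q" and q: "\<And>i. i < n \<Longrightarrow> 0 \<le> q i"
    using density_spectral_decomp[OF assms(2)] by blast
  have \<rho>: "\<rho> \<in> carrier_mat n n" "hermitian \<rho>" "mat_trace \<rho> = 1"
    and \<sigma>: "\<sigma> \<in> carrier_mat n n" "hermitian \<sigma>" "mat_trace \<sigma> = 1"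
    using assms by (auto simp: density_matrices_def)
  define S where "S = {..<n} \<times> {..<n}"
  define W where "W = overlap U V"
  define P where "P = (\<lambda>(i, j). p i * W (i, j))"
  define X where "X = (\<lambda>(i, j). ln (p i) - ln (q j))"
  note trace = mat_trace_mat_fun_mult[OF U V \<rho>(1) \<sigma>(1), folded S_def W_def]
  have W0: "0 \<le> W x" for x by (simp add: W_def overlap_nonneg)
  \<comment> \<open>Pairs with \<open>p i = 0\<close> or \<open>q j = 0\<close> thus have weight
    \<open>P (i, j) = 0\<close>, so the value of \<open>X\<close> there is irrelevant.\<close>
  have zero: "p i = 0 \<or> 0 < q j \<or> W (i, j) = 0" if "(i, j) \<in> S" for i j
    using that q[of j] overlap_eq_0[OF U V \<rho>(1) \<sigma>(1) assms(3), of i j]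
    by (force simp: S_def W_def)
  have pos: "0 < p i \<or> p i = 0" if "(i, j) \<in> S" for i j
    using that p[of i] by (force simp: S_def)
  have "sum P S = Re (mat_trace (mat_fun (\<lambda>x. x) \<rho> * mat_fun (\<lambda>_. 1) \<sigma>))"
    unfolding trace P_def by simp
  also have "\<dots> = 1"
    using \<rho> \<sigma> by (simp add: mat_fun_ident[of _ n] mat_fun_const_one[of _ n] right_mult_one_mat[of _ n n])
  finally have sum_P: "sum P S = 1" .
  interpret finite_distribution S P X
  proof
    show "0 \<le> P x" if "x \<in> S" for x
      using that p W0 by (auto simp: P_def S_def)
  qed (simp_all add: sum_P, simp add: S_def)
  \<comment> \<open>For \<open>p i > 0\<close> the two terms agree. For \<open>p i = 0\<close> the
    left one vanishes while the right one may be positive, hence only an inequality.\<close>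
  have "mgf (- 1) \<le> (\<Sum>(i, j)\<in>S. 1 * q j * W (i, j))"
    unfolding mgf_def
  proof (intro sum_mono, clarify)
    fix i j assume ij: "(i, j) \<in> S"
    then have "0 \<le> q j * W (i, j)" using q W0 by (auto simp: S_def)
    then show "P (i, j) * exp (- 1 * X (i, j)) \<le> 1 * q j * W (i, j)"
      using pos[OF ij] zero[OF ij] by (auto simp: P_def X_def exp_diff)
  qed
  also have "\<dots> = Re (mat_trace (mat_fun (\<lambda>_. 1) \<rho> * mat_fun (\<lambda>x. x) \<sigma>))"
    unfolding trace by simp
  also have "\<dots> = 1"
    using \<rho> \<sigma> by (simp add: mat_fun_ident[of _ n] mat_fun_const_one[of _ n] left_mult_one_mat[of _ n n])
  finally have mgf1: "mgf (- 1) \<le> 1" .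
  have petz: "petz_trace (1 + t) \<rho> \<sigma> = mgf t" for t
    unfolding petz_trace_def mat_powr_def trace mgf_def
  proof (intro sum.cong refl, clarify)
    fix i j assume ij: "(i, j) \<in> S"
    \<comment> \<open>Because \<open>0 powr x = 0\<close> for every \<open>x\<close>, both sides
      vanish when \<open>p i = 0\<close>; when only \<open>q j = 0\<close>, they vanish through
      \<open>W\<close>.\<close>
    show "p i powr (1 + t) * q j powr (1 - (1 + t)) * W (i, j) = P (i, j) * exp (t * X (i, j))"
      using pos[OF ij] zero[OF ij]
      by (auto simp: P_def X_def powr_add powr_minus powr_def[of _ t] exp_diff right_diff_distrib field_simps)
  qed
  define l where "l = (\<lambda>x::real. if x = 0 then 0 else log 2 x)"
  \<comment> \<open>This includes \<open>x = 0\<close>, where \<open>ln 0 = 0\<close> agrees with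
    the convention of \<open>mat_log2\<close>.\<close>
  have l: "l x = ln x / ln 2" for x by (simp add: l_def log_def)
  have "mat_trace (\<rho> * (mat_log2 \<rho> - mat_log2 \<sigma>)) =
      mat_trace (\<rho> * mat_fun l \<rho>) - mat_trace (\<rho> * mat_fun l \<sigma>)"
    unfolding mat_log2_def l_def[symmetric]
    using \<rho>(1) mat_fun_carrier[OF \<rho>(1,2), of l] mat_fun_carrier[OF \<sigma>(1,2), of l]
    by (subst mult_minus_distrib_mat[of _ n n])
      (simp_all add: mat_trace_minus[of _ n] mult_carrier_mat[of _ n n])
  also have "\<rho> * mat_fun l \<rho> = mat_fun (\<lambda>x. x * l x) \<rho> * mat_fun (\<lambda>_. 1) \<sigma>"
    using mat_fun_carrier[OF \<rho>(1,2)]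
    by (simp add: mat_fun_mult[OF \<rho>(1,2)] mat_fun_const_one[OF \<sigma>(1,2)] right_mult_one_mat[of _ n n])
  also have "\<rho> * mat_fun l \<sigma> = mat_fun (\<lambda>x. x) \<rho> * mat_fun l \<sigma>"
    by (simp add: mat_fun_ident[OF \<rho>(1,2)])
  finally have "Re (mat_trace (\<rho> * (mat_log2 \<rho> - mat_log2 \<sigma>))) = mean / ln 2"
    by (simp add: trace mean_def sum_divide_distrib flip: sum_subtractf)
      (intro sum.cong, auto simp: P_def X_def l field_simps)
  then have "rel_entropy \<rho> \<sigma> = ereal (mean / ln 2)" using assms(3) by (simp add: rel_entropy_def)
  then show thesis by (rule that[OF finite_distribution_axioms mgf1 allI[OF petz]])
qed

section \<open>From the scalar bounds back to divergences\<close>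

theorem lemma13:
  fixes n :: nat and \<rho> \<sigma> :: "complex mat"
  assumes "\<rho> \<in> density_matrices n" and "\<sigma> \<in> density_matrices n"
  shows "(\<forall>\<gamma>\<in>{0<..1}. \<forall>\<delta>\<in>{0<..\<gamma> / 2}.
            petz_renyi (1 + \<delta>) \<rho> \<sigma>
              \<le> rel_entropy \<rho> \<sigma> + ereal (ln 2 * \<delta>) * (c_const \<gamma> \<rho> \<sigma>)\<^sup>2
          \<and> rel_entropy \<rho> \<sigma> + ereal (ln 2 * \<delta>) * (c_const \<gamma> \<rho> \<sigma>)\<^sup>2
              \<le> rel_entropy \<rho> \<sigma> + ereal \<delta> * (c_const \<gamma> \<rho> \<sigma>)\<^sup>2)
       \<and> (rel_entropy \<rho> \<sigma> < \<infinity> \<longrightarrow>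
           (\<forall>\<gamma>\<in>{0<..1}. let c = real_of_ereal (c_const \<gamma> \<rho> \<sigma>) in
             (\<forall>\<delta>\<in>{0<..\<gamma> / 2}.
                petz_renyi (1 - \<delta>) \<rho> \<sigma>
                  \<ge> rel_entropy \<rho> \<sigma> - ereal (ln 2 * \<delta> * c\<^sup>2 * cosh (ln 2 * \<delta> * c)))
           \<and> (\<forall>\<delta>\<in>{0<..log 2 3 / (2 * c)}.
                petz_renyi (1 - \<delta>) \<rho> \<sigma>
                  \<ge> rel_entropy \<rho> \<sigma> - ereal (ln 2 * cosh (log 2 3 / 2) * \<delta> * c\<^sup>2)
              \<and> rel_entropy \<rho> \<sigma> - ereal (ln 2 * cosh (log 2 3 / 2) * \<delta> * c\<^sup>2)
                  \<ge> rel_entropy \<rho> \<sigma> - ereal (\<delta> * c\<^sup>2))))"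
proof (cases "supp \<rho> \<subseteq> supp \<sigma>")
  case False
  \<comment> \<open>Without inclusion of supports the upper bounds are infinite and the premise of
    the lower bounds fails.\<close>
  then have inf: "rel_entropy \<rho> \<sigma> = \<infinity>" "\<And>\<gamma>. c_const \<gamma> \<rho> \<sigma> = \<infinity>"
    by (simp_all add: rel_entropy_def c_const_def)
  then show ?thesis by (auto simp: power2_eq_square)
next
  case True
  show ?thesis
  proof (rule nussbaum_szkola[OF assms True])
    fix S :: "(nat \<times> nat) set" and P X
    assume fin: "finite_distribution S P"
      and mgf1: "finite_distribution.mgf S P X (- 1) \<le> 1"
      and petz: "\<forall>t. petz_trace (1 + t) \<rho> \<sigma> = finite_distribution.mgf S P X t"
      and D: "rel_entropy \<rho> \<sigma> = ereal (finite_distribution.mean S P X / ln 2)"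
    interpret finite_distribution S P X by (rule fin)
    let ?L = "ln 2 :: real"
    have L: "0 < ?L" "?L \<le> 1" using ln_2_less_1 by auto
    have renyi: "petz_renyi (1 + t) \<rho> \<sigma> = ereal (ln (mgf t) / (t * ?L))" for t
      using True by (simp add: petz_renyi_def petz log_def)
    have renyi': "petz_renyi (1 - t) \<rho> \<sigma> = ereal (ln (mgf (- t)) / (- t * ?L))" for t
      using renyi[of "- t"] by simp
    \<comment> \<open>The two powers of 2 in \<open>c_const\<close> are exactly
      \<open>mgf \<gamma>\<close> and \<open>mgf (- \<gamma>)\<close>.\<close>
    have c: "c_const \<gamma> \<rho> \<sigma> = ereal (cumulant_const \<gamma> / ?L)" if "0 < \<gamma>" for \<gamma>
      using that True mgf_pos
      by (simp add: c_const_def renyi renyi' cumulant_const_def log_def powr_def)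
    have upper: "petz_renyi (1 + \<delta>) \<rho> \<sigma> \<le> rel_entropy \<rho> \<sigma> + ereal (?L * \<delta>) * (c_const \<gamma> \<rho> \<sigma>)\<^sup>2
        \<and> rel_entropy \<rho> \<sigma> + ereal (?L * \<delta>) * (c_const \<gamma> \<rho> \<sigma>)\<^sup>2
          \<le> rel_entropy \<rho> \<sigma> + ereal \<delta> * (c_const \<gamma> \<rho> \<sigma>)\<^sup>2"
      if d: "0 < \<delta>" "\<delta> \<le> \<gamma> / 2" for \<delta> \<gamma>
    proof -
      define C where "C = cumulant_const \<gamma>"
      have "ln (mgf \<delta>) / (\<delta> * ?L) \<le> (\<delta> * mean + (\<delta> * C)\<^sup>2) / (\<delta> * ?L)"
        unfolding C_def using d L ln_mgf_le[OF d mean_nonneg[OF mgf1]] by (intro divide_right_mono) auto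
      also have "\<dots> = mean / ?L + ?L * \<delta> * (C / ?L)\<^sup>2"
        using d L by (simp add: field_simps power2_eq_square)
      finally have "ln (mgf \<delta>) / (\<delta> * ?L) \<le> mean / ?L + ?L * \<delta> * (C / ?L)\<^sup>2" .
      moreover have "?L * \<delta> * (C / ?L)\<^sup>2 \<le> \<delta> * (C / ?L)\<^sup>2"
        using d L by (intro mult_right_mono) auto
      ultimately show ?thesis
        using d by (simp add: c renyi D C_def[symmetric])
    qed
    have lower: "mean / ?L - ?L * \<delta> * c\<^sup>2 * cosh (?L * \<delta> * c) \<le> ln (mgf (- \<delta>)) / (- \<delta> * ?L)"
      if d: "0 < \<delta>" "\<delta> \<le> \<gamma> / 2" and c: "c = cumulant_const \<gamma> / ?L" for \<delta> \<gamma> c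
    proof -
      have "(- \<delta> * mean + (\<delta> * (?L * c))\<^sup>2 * cosh (\<delta> * (?L * c))) / (- \<delta> * ?L)
          \<le> ln (mgf (- \<delta>)) / (- \<delta> * ?L)"
        using d L ln_mgf_minus_le[OF d] c
        by (intro divide_right_mono_neg) (auto simp: mult_nonneg_nonneg)
      also have "(- \<delta> * mean + (\<delta> * (?L * c))\<^sup>2 * cosh (\<delta> * (?L * c))) / (- \<delta> * ?L)
          = mean / ?L - ?L * \<delta> * c\<^sup>2 * cosh (?L * \<delta> * c)"
        using d L by (simp add: field_simps power2_eq_square)
      finally show ?thesis .
    qed
    have lower': "mean / ?L - ?L * cosh (log 2 3 / 2) * \<delta> * c\<^sup>2 \<le> ln (mgf (- \<delta>)) / (- \<delta> * ?L)"
      if g: "0 < \<gamma>" and d: "0 < \<delta>" "\<delta> \<le> log 2 3 / (2 * c)" and c: "c = cumulant_const \<gamma> / ?L" for \<delta> \<gamma> c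
    proof -
      \<comment> \<open>This makes the range of \<delta> here a subset of \<delta> \<le> \<gamma> /
        2, so \<open>lower\<close> applies.\<close>
      have c_ge: "log 2 3 / \<gamma> \<le> c"
        using cumulant_const_ge[OF g] L by (simp add: c log_def field_simps)
      have "0 < log 2 3 / \<gamma>" using g log2_3_bounds by simp
      then have c0: "0 < c" using c_ge by linarith
      have dc: "\<delta> * c \<le> log 2 3 / 2" using d c0 by (simp add: field_simps)
      have "\<delta> \<le> log 2 3 / (2 * (log 2 3 / \<gamma>))"
        using d(2) c_ge c0 g log2_3_bounds
        by (elim order_trans) (intro divide_left_mono, auto)
      then have d2: "\<delta> \<le> \<gamma> / 2" using log2_3_bounds g by simp
      \<comment> \<open>The factor \<open>?L \<le> 1\<close> in the argument of \<open>cosh\<close>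
        is simply dropped.\<close>
      have "?L * (\<delta> * c) \<le> log 2 3 / 2"
        using L d c0 by (intro order_trans[OF mult_left_le_one_le dc]) auto
      then have "cosh (?L * \<delta> * c) \<le> cosh (log 2 3 / 2)"
        using dc L d c0 by (intro cosh_real_nonneg_le_iff[THEN iffD2]) (simp_all add: mult.assoc)
      then have "?L * \<delta> * c\<^sup>2 * cosh (?L * \<delta> * c) \<le> ?L * \<delta> * c\<^sup>2 * cosh (log 2 3 / 2)"
        using L d by (intro mult_left_mono) auto
      then show ?thesis using lower[OF d(1) d2 c] by (simp add: mult_ac)
    qed
    have final: "?L * cosh (log 2 3 / 2) * \<delta> * c\<^sup>2 \<le> \<delta> * c\<^sup>2" if "0 < \<delta>" for \<delta> c :: real
      using that ln2_cosh_log2_3_le_1 mult_right_mono[of "?L * cosh (log 2 3 / 2)" 1 "\<delta> * c\<^sup>2"]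
      by (simp add: mult.assoc)
    show ?thesis
      using upper lower lower' final by (auto simp: Let_def c renyi' D)
  qed
qed

end
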